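(* Let $\epsilon>0$ and set $\rho=\frac{\epsilon}{4D_f}$, $\mu=\frac{\epsilon}{4D_g}$, $\kappa=\frac{\epsilon}{2R^2}$ and $L=\frac{\|A\|^2}{\rho}+\frac1\mu+\kappa$. Let $(p_k)_{k\ge 0}$ be the sequence generated by the fast gradient method described in the context, applied to $\theta_{\rho,\mu,\kappa}$. Then for every integer $k\ge 0$ with $$k \ge 2\sqrt{\frac{L}{\kappa}}\,\ln\left(\frac{25\left(\theta(0)-\theta(p^* )+\frac{\epsilon}{2}\right)}{2\epsilon}\right)$$ one has $\theta(p_k)+v(D)\le \epsilon$. Here $$\frac{L}{\kappa}=1+\frac{8R^2}{\epsilon^2}\left(\|A\|^2D_f+D_g\right),$$ so that, for fixed problem data, $k=O\left(\frac1\epsilon\ln\left(\frac1\epsilon\right)\right)$ iterations suffice (as $\epsilon\downarrow 0$) to obtain $\theta(p_k)+v(D)\le\epsilon$.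
   Context: Let $f:\mathbb{R}^n\to\overline{\mathbb{R}}=\mathbb{R}\cup\{\pm\infty\}$ and $g:\mathbb{R}^m\to\overline{\mathbb{R}}$ be proper, convex and lower semicontinuous functions with bounded effective domains $\operatorname{dom} f=\{x: f(x)<+\infty\}$ and $\operatorname{dom} g$, and let $A:\mathbb{R}^n\to\mathbb{R}^m$ be linear with $A(\operatorname{dom} f)\cap\operatorname{dom} g\ne\emptyset$. Norms are Euclidean, $\|A\|$ is the operator norm, $A^*$ the adjoint, and $f^*(q)=\sup_x\{\langle q,x\rangle-f(x)\}$ the conjugate (similarly $g^*$); both conjugates are finite everywhere. The primal problem is $(P)$: $\inf_{x\in\mathbb{R}^n}\{f(x)+g(Ax)\}$. Its Fenchel dual is $(D)$: $\sup_{p\in\mathbb{R}^m}\{-f^*(A^*p)-g^*(-p)\}=-\inf_{p}\theta(p)$, where $\theta(p)=f^*(A^*p)+g^*(-p)$. Let $v(D)$ be the optimal value of $(D)$. It is assumed that $(D)$ has an optimal solution $p^*\in\mathbb{R}^m$ and that $R>0$ is a real number with $\|p^*\|\le R$; thus $\theta(p^* )=-v(D)$. Put $D_f=\sup\{\frac{\|x\|^2}{2}:x\in\operatorname{dom} f\}$ and $D_g=\sup\{\frac{\|x\|^2}{2}:x\in\operatorname{dom} g\}$, assumed positive (they are finite by boundedness). For $\rho,\mu,\kappa>0$ define $f_\rho^*(A^*p)=\sup_{x\in\mathbb{R}^n}\{\langle A^*p,x\rangle-f(x)-\frac\rho2\|x\|^2\}$, $g_\mu^*(-p)=\sup_{x\in\mathbb{R}^m}\{\langle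 -p,x\rangle-g(x)-\frac\mu2\|x\|^2\}$, $\theta_{\rho,\mu}(p)=f_\rho^*(A^*p)+g_\mu^*(-p)$ and $\theta_{\rho,\mu,\kappa}(p)=\theta_{\rho,\mu}(p)+\frac\kappa2\|p\|^2$. With $x_{\rho,p}$ and $x_{\mu,p}$ denoting the unique maximizers in the definitions of $f_\rho^*(A^*p)$ and $g_\mu^*(-p)$ respectively, $\theta_{\rho,\mu,\kappa}$ is differentiable with $\nabla\theta_{\rho,\mu,\kappa}(p)=Ax_{\rho,p}-x_{\mu,p}+\kappa p$, which is Lipschitz continuous with constant $L=\frac{\|A\|^2}{\rho}+\frac1\mu+\kappa$. Fast gradient method applied to $\theta_{\rho,\mu,\kappa}$: set $w_0=p_0=0\in\mathbb{R}^m$, and for $k\ge0$ $$p_{k+1}=w_k-\frac1L\nabla\theta_{\rho,\mu,\kappa}(w_k),\qquad w_{k+1}=p_{k+1}+\frac{\sqrt L-\sqrt\kappa}{\sqrt L+\sqrt\kappa}\,(p_{k+1}-p_k).$$ *)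

theory Defs
  imports "HOL-Analysis.Analysis" "HOL-Library.Landau_Symbols"
begin

definition effective_domain :: "('a \<Rightarrow> ereal) \<Rightarrow> 'a set" where
  "effective_domain f = {x. f x < \<infinity>}"

definition proper_fun :: "('a \<Rightarrow> ereal) \<Rightarrow> bool" where
  "proper_fun f \<longleftrightarrow> (\<forall>x. f x \<noteq> -\<infinity>) \<and> effective_domain f \<noteq> {}"

text \<open>The convexity inequality is only used for proper functions, so the right-hand side never
  has the form \<open>\<infinity> - \<infinity>\<close>.  Since \<open>0 * \<infinity> = 0\<close> in \<open>ereal\<close>, the end points \<open>u = 0\<close> and \<open>v = 0\<close>
  impose nothing.\<close>
definition convex_fun :: "('a::real_vector \<Rightarrow> ereal) \<Rightarrow> bool" where
  "convex_fun f \<longleftrightarrow> (\<forall>x y. \<forall>u\<ge>0. \<forall>v\<ge>0. u + v = 1 \<longrightarrow>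
     f (u *\<^sub>R x + v *\<^sub>R y) \<le> ereal u * f x + ereal v * f y)"

definition lsc_fun :: "('a::topological_space \<Rightarrow> ereal) \<Rightarrow> bool" where
  "lsc_fun f \<longleftrightarrow> (\<forall>x. f x \<le> Liminf (at x) f)"

definition conjugate :: "('a::real_inner \<Rightarrow> ereal) \<Rightarrow> 'a \<Rightarrow> ereal" where
  "conjugate f q = (SUP x. ereal (q \<bullet> x) - f x)"

definition smoothed_conjugate :: "real \<Rightarrow> ('a::real_inner \<Rightarrow> ereal) \<Rightarrow> 'a \<Rightarrow> ereal" where
  "smoothed_conjugate \<rho> f q = (SUP x. ereal (q \<bullet> x) - f x - ereal (\<rho> / 2 * (norm x)\<^sup>2))"

definition dual_value ::
  "('a::real_inner \<Rightarrow> ereal) \<Rightarrow> ('b::real_inner \<Rightarrow> ereal) \<Rightarrow> ('a \<Rightarrow> 'b) \<Rightarrow> ereal" where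
  "dual_value f g A = (SUP p. - conjugate f (adjoint A p) - conjugate g (- p))"

definition dual_solution ::
  "('a::real_inner \<Rightarrow> ereal) \<Rightarrow> ('b::real_inner \<Rightarrow> ereal) \<Rightarrow> ('a \<Rightarrow> 'b) \<Rightarrow> 'b \<Rightarrow> bool" where
  "dual_solution f g A p \<longleftrightarrow>
     - conjugate f (adjoint A p) - conjugate g (- p) = dual_value f g A"

definition dual_theta ::
  "('a::real_inner \<Rightarrow> ereal) \<Rightarrow> ('b::real_inner \<Rightarrow> ereal) \<Rightarrow> ('a \<Rightarrow> 'b) \<Rightarrow> 'b \<Rightarrow> ereal" where
  "dual_theta f g A p = conjugate f (adjoint A p) + conjugate g (- p)"

definition smoothed_theta ::
  "('a::real_inner \<Rightarrow> ereal) \<Rightarrow> ('b::real_inner \<Rightarrow> ereal) \<Rightarrow> ('a \<Rightarrow> 'b) \<Rightarrow>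
     real \<Rightarrow> real \<Rightarrow> 'b \<Rightarrow> ereal" where
  "smoothed_theta f g A \<rho> \<mu> p =
     smoothed_conjugate \<rho> f (adjoint A p) + smoothed_conjugate \<mu> g (- p)"

definition doubly_smoothed_theta ::
  "('a::real_inner \<Rightarrow> ereal) \<Rightarrow> ('b::real_inner \<Rightarrow> ereal) \<Rightarrow> ('a \<Rightarrow> 'b) \<Rightarrow>
     real \<Rightarrow> real \<Rightarrow> real \<Rightarrow> 'b \<Rightarrow> ereal" where
  "doubly_smoothed_theta f g A \<rho> \<mu> \<kappa> p =
     smoothed_theta f g A \<rho> \<mu> p + ereal (\<kappa> / 2 * (norm p)\<^sup>2)"

text \<open>Used only for a proper function with bounded effective domain, where the supremum is over a
  nonempty set that is bounded above.\<close>
definition domain_bound :: "('a::real_normed_vector \<Rightarrow> ereal) \<Rightarrow> real" where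
  "domain_bound f = (SUP x\<in>effective_domain f. (norm x)\<^sup>2 / 2)"

definition gradient :: "('a::real_inner \<Rightarrow> real) \<Rightarrow> 'a \<Rightarrow> 'a" where
  "gradient F x = (THE D. GDERIV F x :> D)"

text \<open>The pair \<open>(p\<^sub>k, w\<^sub>k)\<close> of iterates.\<close>
primrec fast_gradient ::
  "('a::real_inner \<Rightarrow> real) \<Rightarrow> real \<Rightarrow> real \<Rightarrow> nat \<Rightarrow> 'a \<times> 'a" where
  "fast_gradient F L \<kappa> 0 = (0, 0)"
| "fast_gradient F L \<kappa> (Suc k) =
     (let p = fst (fast_gradient F L \<kappa> k);
          w = snd (fast_gradient F L \<kappa> k);
          p' = w - (1 / L) *\<^sub>R gradient F w
      in (p', p' + ((sqrt L - sqrt \<kappa>) / (sqrt L + sqrt \<kappa>)) *\<^sub>R (p' - p)))"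

end

(*
  Let F be the doubly smoothed function.  A strongly concave perturbation of q \<bullet> x - f x has a
  maximizer x_q and drops by at least rho/2 |x - x_q|^2 away from it, so completing the square
  sandwiches the smoothed conjugate between its affine minorant q' |-> h(q) + x_q \<bullet> (q' - q) and
  that minorant plus |q' - q|^2 / (2 rho).  This gives the gradient and the descent inequality at
  once.  For q = sqrt (kappa / L) the quantity F(p_k) - F(z) + kappa/2 |v_k - z|^2 then contracts
  by 1 - q in every step, for every z.  Taking z = pstar instead of the minimizer of F, the initial
  value is theta_{rho,mu}(0) - theta_{rho,mu}(pstar) <= M := theta(0) - theta(pstar) + epsilon/2, hence
  theta(p_k) - theta(pstar) <= (1 - q)^k M + kappa R^2 / 2 + rho D_f + mu D_g, and the last three
  terms are epsilon/4 each.
*)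
theory Submission
  imports Defs
begin

section \<open>Smoothing by a quadratic term\<close>

lemma onorm_adjoint_bound:
  fixes A :: "'a::euclidean_space \<Rightarrow> 'b::euclidean_space"
  assumes "linear A"
  shows "norm (adjoint A d) \<le> onorm A * norm d"
proof (cases "adjoint A d = 0")
  case False
  have "norm (adjoint A d) * norm (adjoint A d) = adjoint A d \<bullet> adjoint A d"
    by (simp add: dot_square_norm power2_eq_square)
  also have "\<dots> = A (adjoint A d) \<bullet> d"
    using adjoint_works[OF assms] by simp
  also have "\<dots> \<le> norm (A (adjoint A d)) * norm d"
    by (rule norm_cauchy_schwarz)
  also have "\<dots> \<le> onorm A * norm (adjoint A d) * norm d"
    using onorm[of A "adjoint A d"] assms
    by (intro mult_right_mono) (auto simp: linear_conv_bounded_linear)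
  finally show ?thesis
    using False by (simp add: mult.commute mult.left_commute)
qed (use assms in \<open>simp add: linear_conv_bounded_linear onorm_pos_le\<close>)

text \<open>The error quotient is at most \<open>C * norm (y - x)\<close>, which tends to 0.
  Differentiability of the smoothed function thus follows from two-sided quadratic bounds, without
  differentiating a supremum.\<close>

lemma GDERIV_of_quadratic_error:
  assumes "\<And>y. \<bar>F y - F x - D \<bullet> (y - x)\<bar> \<le> C * (norm (y - x))\<^sup>2"
  shows "GDERIV F x :> D"
  unfolding gderiv_def
proof (rule has_derivativeI_sandwich[where e = 1 and H = "\<lambda>y. C * norm (y - x)"])
  show "bounded_linear (\<lambda>h. h \<bullet> D)" by (rule bounded_linear_inner_left)
  show "((\<lambda>y. C * norm (y - x)) \<longlongrightarrow> 0) (at x)"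
    by (rule tendsto_eq_intros refl | simp)+
  fix y assume "y \<noteq> x"
  then show "norm (F y - F x - (y - x) \<bullet> D) / norm (y - x) \<le> C * norm (y - x)"
    using assms[of y] by (simp add: divide_simps power2_eq_square mult.assoc inner_commute)
qed simp_all

lemma GDERIV_unique: "GDERIV F x :> D \<Longrightarrow> GDERIV F x :> E \<Longrightarrow> D = E"
  unfolding gderiv_def
  by (metis has_derivative_unique inner_commute vector_eq_ldot)

lemma gradient_eq: "GDERIV F x :> D \<Longrightarrow> gradient F x = D"
  unfolding gradient_def by (blast intro: GDERIV_unique)

section \<open>Attainment and finiteness of conjugates\<close>

lemma lsc_attains_inf:
  fixes \<phi> :: "'a::topological_space \<Rightarrow> 'b::linorder"
  assumes "\<And>c. open {x. c < \<phi> x}" "compact K" "K \<noteq> {}"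
  obtains x where "x \<in> K" "\<And>y. y \<in> K \<Longrightarrow> \<phi> x \<le> \<phi> y"
proof (rule ccontr)
  assume "\<not> thesis"
  with that have "\<And>x. x \<in> K \<Longrightarrow> \<exists>y\<in>K. \<phi> y < \<phi> x" by (meson not_le)
  \<comment> \<open>Without a minimizer these open superlevel sets cover \<open>K\<close>. Among the
    finitely many indices of a subcover, one of least value lies in \<open>K\<close> but in none of
    the chosen sets.\<close>
  then have "K \<subseteq> (\<Union>y\<in>K. {x. \<phi> y < \<phi> x})" by blast
  from compactE_image[OF assms(2) assms(1) this]
  obtain C where C: "C \<subseteq> K" "finite C" "K \<subseteq> (\<Union>y\<in>C. {x. \<phi> y < \<phi> x})" by metis
  with assms(3) have "C \<noteq> {}" by auto
  then obtain y where "y \<in> C" "\<And>z. z \<in> C \<Longrightarrow> \<phi> y \<le> \<phi> z"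
    using C(2) ex_is_arg_min_if_finite[of C \<phi>] by (auto simp: is_arg_min_linorder)
  with C show False by (fastforce simp: not_less[symmetric])
qed

text \<open>A real \<open>d\<close> strictly between \<open>c - k x\<close> and \<open>f x\<close>
  splits the inequality: near \<open>x\<close>, \<open>f\<close> stays above \<open>d\<close> by
  semicontinuity and \<open>d + k y\<close> stays above \<open>c\<close> by continuity.\<close>

lemma lsc_fun_add_continuous:
  fixes f :: "'a::metric_space \<Rightarrow> ereal"
  assumes "lsc_fun f" "\<And>x. f x \<noteq> -\<infinity>" "continuous_on UNIV k"
  shows "open {x. c < f x + ereal (k x)}"
proof -
  have "\<forall>\<^sub>F y in nhds x. c < f y + ereal (k y)" if "c < f x + ereal (k x)" for x
  proof -
    have "c - ereal (k x) < f x"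
      using that assms(2)[of x] by (cases c; cases "f x") auto
    then obtain d where d: "c - ereal (k x) < ereal d" "ereal d < f x"
      using ereal_dense2 by blast
    have "\<forall>\<^sub>F y in at x. ereal d < f y"
      using assms(1) d(2) unfolding lsc_fun_def le_Liminf_iff by blast
    \<comment> \<open>\<open>Liminf (at x)\<close> ignores the point \<open>x\<close> itself;
      \<open>d < f x\<close> fills this hole in the neighbourhood.\<close>
    with d(2) have 1: "\<forall>\<^sub>F y in nhds x. ereal d < f y"
      by (simp add: eventually_nhds_conv_at)
    have "(k \<longlongrightarrow> k x) (nhds x)"
      using assms(3) by (metis UNIV_I continuous_on_eq_continuous_at isCont_def open_UNIV tendsto_nhds_iff)
    then have "((\<lambda>y. ereal (d + k y)) \<longlongrightarrow> ereal (d + k x)) (nhds x)"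
      by (intro tendsto_intros)
    moreover have "c < ereal (d + k x)" using d(1) by (cases c) auto
    ultimately have 2: "\<forall>\<^sub>F y in nhds x. c < ereal (d + k y)" by (rule order_tendstoD)
    from 1 2 show ?thesis
    proof eventually_elim
      case (elim y)
      then show ?case by (cases c; cases "f y") auto
    qed
  qed
  then have "\<exists>T. open T \<and> x \<in> T \<and> T \<subseteq> {x. c < f x + ereal (k x)}"
    if "c < f x + ereal (k x)" for x
    using that unfolding eventually_nhds subset_eq mem_Collect_eq by blast
  then show ?thesis by (subst open_subopen) simp
qed

text \<open>The negated objective is lower semicontinuous, so it has a minimum on the compact
  closure of the domain. Off the domain it is infinite, so this minimum is global, and properness
  makes it finite. No sign of \<rho> enters, so \<rho> = 0 yields the ordinary conjugate.\<close>

lemma smoothed_conjugate_attained: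
  fixes f :: "'a::euclidean_space \<Rightarrow> ereal"
  assumes f: "proper_fun f" "lsc_fun f" "bounded (effective_domain f)"
  obtains x where "x \<in> effective_domain f"
    "smoothed_conjugate \<rho> f q = ereal (q \<bullet> x - real_of_ereal (f x) - \<rho> / 2 * (norm x)\<^sup>2)"
proof -
  let ?k = "\<lambda>x. \<rho> / 2 * (norm x)\<^sup>2 - q \<bullet> x"
  have pr: "f x \<noteq> -\<infinity>" for x using f(1) by (simp add: proper_fun_def)
  have "open {x. c < f x + ereal (?k x)}" for c
    by (intro lsc_fun_add_continuous f pr continuous_intros)
  moreover have "compact (closure (effective_domain f))" "closure (effective_domain f) \<noteq> {}"
    using f by (auto simp: proper_fun_def compact_closure)
  ultimately obtain x where x: "\<And>y. y \<in> closure (effective_domain f) \<Longrightarrow>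
      f x + ereal (?k x) \<le> f y + ereal (?k y)"
    by (rule lsc_attains_inf) blast
  have le: "f x + ereal (?k x) \<le> f y + ereal (?k y)" for y
  proof (cases "y \<in> effective_domain f")
    case True
    then show ?thesis using x closure_subset by blast
  qed (simp add: effective_domain_def)
  obtain y where "f y < \<infinity>" using f(1) by (auto simp: proper_fun_def effective_domain_def)
  with le[of y] have xd: "f x < \<infinity>" by (cases "f x"; cases "f y") auto
  with pr[of x] obtain c where c: "f x = ereal c" by (cases "f x") auto
  have "smoothed_conjugate \<rho> f q = ereal (q \<bullet> x - c - \<rho> / 2 * (norm x)\<^sup>2)"
    unfolding smoothed_conjugate_def
  proof (rule antisym)
    show "(SUP x. ereal (q \<bullet> x) - f x - ereal (\<rho> / 2 * (norm x)\<^sup>2))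
        \<le> ereal (q \<bullet> x - c - \<rho> / 2 * (norm x)\<^sup>2)"
    proof (rule SUP_least)
      fix y show "ereal (q \<bullet> y) - f y - ereal (\<rho> / 2 * (norm y)\<^sup>2)
        \<le> ereal (q \<bullet> x - c - \<rho> / 2 * (norm x)\<^sup>2)"
        using le[of y] c pr[of y] by (cases "f y") auto
    qed
  qed (rule SUP_upper2[of x], auto simp: c)
  with that[of x] xd c show thesis by (simp add: effective_domain_def)
qed

lemma conjugate_eq_smoothed_conjugate: "conjugate f = smoothed_conjugate 0 f"
  unfolding conjugate_def smoothed_conjugate_def by simp

text \<open>Real-valued form for arithmetic; \<open>smoothed_conjugate_finite\<close> shows that the
  coercion loses nothing for proper lower semicontinuous functions with bounded domain.\<close>

abbreviation (input) rconj :: "real \<Rightarrow> ('a::real_inner \<Rightarrow> ereal) \<Rightarrow> 'a \<Rightarrow> real" where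
  "rconj \<rho> f q \<equiv> real_of_ereal (smoothed_conjugate \<rho> f q)"

lemma smoothed_conjugate_finite:
  fixes f :: "'a::euclidean_space \<Rightarrow> ereal"
  assumes "proper_fun f" "lsc_fun f" "bounded (effective_domain f)"
  shows "smoothed_conjugate \<rho> f q = ereal (rconj \<rho> f q)"
  using smoothed_conjugate_attained[OF assms] by (metis real_of_ereal.simps(1))

text \<open>The Fenchel-Young inequality. Membership in the domain matters:
  \<open>real_of_ereal\<close> would send an infinite \<open>f x\<close> to 0.\<close>

lemma smoothed_conjugate_ge:
  fixes f :: "'a::euclidean_space \<Rightarrow> ereal"
  assumes f: "proper_fun f" "lsc_fun f" "bounded (effective_domain f)"
    and x: "x \<in> effective_domain f"
  shows "q \<bullet> x - real_of_ereal (f x) - \<rho> / 2 * (norm x)\<^sup>2 \<le> rconj \<rho> f q"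
proof -
  have "f x = ereal (real_of_ereal (f x))"
    using f(1) x by (cases "f x") (auto simp: proper_fun_def effective_domain_def)
  then have "ereal (q \<bullet> x - real_of_ereal (f x) - \<rho> / 2 * (norm x)\<^sup>2)
      = ereal (q \<bullet> x) - f x - ereal (\<rho> / 2 * (norm x)\<^sup>2)"
    by (metis ereal_minus(1))
  also have "\<dots> \<le> smoothed_conjugate \<rho> f q"
    unfolding smoothed_conjugate_def by (rule SUP_upper) simp
  finally show ?thesis by (subst (asm) smoothed_conjugate_finite[OF f]) simp
qed

section \<open>Error caused by smoothing\<close>

lemma smoothed_conjugate_antimono:
  fixes f :: "'a::euclidean_space \<Rightarrow> ereal"
  assumes f: "proper_fun f" "lsc_fun f" "bounded (effective_domain f)" and "\<rho> \<ge> 0"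
  shows "rconj \<rho> f q \<le> rconj 0 f q"
proof -
  obtain x where x: "x \<in> effective_domain f"
    "smoothed_conjugate \<rho> f q = ereal (q \<bullet> x - real_of_ereal (f x) - \<rho> / 2 * (norm x)\<^sup>2)"
    using smoothed_conjugate_attained[OF f] .
  have "0 \<le> \<rho> / 2 * (norm x)\<^sup>2" using assms by simp
  with x smoothed_conjugate_ge[OF f x(1), of q 0] show ?thesis by simp
qed

lemma norm_le_domain_bound:
  assumes "bounded (effective_domain f)" "x \<in> effective_domain f"
  shows "(norm x)\<^sup>2 / 2 \<le> domain_bound f"
proof -
  obtain B where "\<And>y. y \<in> effective_domain f \<Longrightarrow> norm y \<le> B"
    using assms(1) by (auto simp: bounded_iff)
  then have "bdd_above ((\<lambda>x. (norm x)\<^sup>2 / 2) ` effective_domain f)"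
    by (intro bdd_aboveI2[where M = "B\<^sup>2 / 2"]) (simp add: power_mono)
  then show ?thesis unfolding domain_bound_def by (rule cSUP_upper[OF assms(2)])
qed

text \<open>The maximizer for parameter 0 competes in the smoothed supremum, where its penalty is at
  most \<open>\<rho> * domain_bound f\<close>. In \<open>smoothed_conjugate_antimono\<close> the
  roles are exchanged.\<close>

lemma smoothed_conjugate_error:
  fixes f :: "'a::euclidean_space \<Rightarrow> ereal"
  assumes f: "proper_fun f" "lsc_fun f" "bounded (effective_domain f)" and "\<rho> \<ge> 0"
  shows "rconj 0 f q \<le> rconj \<rho> f q + \<rho> * domain_bound f"
proof -
  obtain x where x: "x \<in> effective_domain f"
    "smoothed_conjugate 0 f q = ereal (q \<bullet> x - real_of_ereal (f x) - 0 / 2 * (norm x)\<^sup>2)"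
    using smoothed_conjugate_attained[OF f] .
  have "\<rho> * ((norm x)\<^sup>2 / 2) \<le> \<rho> * domain_bound f"
    using norm_le_domain_bound[OF f(3) x(1)] assms(4) by (rule mult_left_mono)
  with x smoothed_conjugate_ge[OF f x(1), of q \<rho>] show ?thesis by simp
qed

section \<open>Strong concavity and the quadratic sandwich\<close>

lemma norm_diff_sq_scaleR:
  fixes x y :: "'a::real_inner"
  shows "(norm (x - c *\<^sub>R y))\<^sup>2 = (norm x)\<^sup>2 - 2 * c * (y \<bullet> x) + c\<^sup>2 * (norm y)\<^sup>2"
  unfolding power2_norm_eq_inner
  by (simp add: inner_diff inner_commute[of x y] power2_eq_square algebra_simps)

lemma norm_convex_combination_sq:
  fixes x y :: "'a::real_inner"
  shows "(norm ((1 - t) *\<^sub>R x + t *\<^sub>R y))\<^sup>2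
    = (1 - t) * (norm x)\<^sup>2 + t * (norm y)\<^sup>2 - t * (1 - t) * (norm (y - x))\<^sup>2"
  unfolding power2_norm_eq_inner
  by (simp add: inner_add inner_diff inner_commute[of y x] algebra_simps)

text \<open>The maximizer \<open>z\<close> is compared with a point of the segment towards
  \<open>x\<close>. Convexity of \<open>f\<close> and the exact identity for the squared norm leave
  an inequality with a common factor \<open>t\<close>; dividing by it and letting \<open>t\<close>
  tend to 0 gives the full constant \<open>\<rho> / 2\<close>.\<close>

lemma smoothed_conjugate_strong_max:
  fixes f :: "'a::euclidean_space \<Rightarrow> ereal"
  assumes f: "proper_fun f" "convex_fun f" "lsc_fun f" "bounded (effective_domain f)"
    and z: "z \<in> effective_domain f"
      "rconj \<rho> f q = q \<bullet> z - real_of_ereal (f z) - \<rho> / 2 * (norm z)\<^sup>2"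
    and x: "x \<in> effective_domain f"
  shows "q \<bullet> x - real_of_ereal (f x) - \<rho> / 2 * (norm x)\<^sup>2 + \<rho> / 2 * (norm (x - z))\<^sup>2
    \<le> rconj \<rho> f q"
proof -
  let ?r = "\<lambda>x. real_of_ereal (f x)"
  let ?\<phi> = "\<lambda>x. q \<bullet> x - ?r x - \<rho> / 2 * (norm x)\<^sup>2"
  have fin: "f y = ereal (?r y)" if "y \<in> effective_domain f" for y
    using f(1) that by (cases "f y") (auto simp: proper_fun_def effective_domain_def)
  have step: "?\<phi> x + \<rho> / 2 * (1 - t) * (norm (x - z))\<^sup>2 \<le> ?\<phi> z" if t: "0 < t" "t < 1" for t
  proof -
    let ?y = "(1 - t) *\<^sub>R z + t *\<^sub>R x"
    have "f ?y \<le> ereal (1 - t) * f z + ereal t * f x"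
      using f(2) t unfolding convex_fun_def by simp
    also have "\<dots> = ereal ((1 - t) * ?r z + t * ?r x)"
      by (subst fin[OF z(1)], subst fin[OF x]) simp
    finally have le: "f ?y \<le> ereal ((1 - t) * ?r z + t * ?r x)" .
    then have yd: "?y \<in> effective_domain f"
      by (auto simp: effective_domain_def)
    with le fin[OF yd] have r: "?r ?y \<le> (1 - t) * ?r z + t * ?r x"
      by (metis ereal_less_eq(3))
    have "q \<bullet> ?y - ((1 - t) * ?r z + t * ?r x) - \<rho> / 2 * (norm ?y)\<^sup>2 \<le> ?\<phi> z"
      using smoothed_conjugate_ge[OF f(1,3,4) yd, of q \<rho>] r z(2) by linarith
    moreover define h where "h = \<rho> / 2"
    ultimately have "t * (?\<phi> x + \<rho> / 2 * (1 - t) * (norm (x - z))\<^sup>2) \<le> t * ?\<phi> z"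
      unfolding norm_convex_combination_sq h_def[symmetric]
      by (simp add: inner_add algebra_simps)
    then show ?thesis using t by simp
  qed
  have "((\<lambda>t. ?\<phi> x + \<rho> / 2 * (1 - t) * (norm (x - z))\<^sup>2) \<longlongrightarrow>
      ?\<phi> x + \<rho> / 2 * (1 - 0) * (norm (x - z))\<^sup>2) (at_right 0)"
    by (intro tendsto_intros)
  moreover have "\<forall>\<^sub>F t in at_right 0. ?\<phi> x + \<rho> / 2 * (1 - t) * (norm (x - z))\<^sup>2 \<le> ?\<phi> z"
    using step by (auto simp: eventually_at_right_field intro!: exI[of _ 1])
  ultimately show ?thesis
    using z(2) tendsto_upperbound trivial_limit_at_right_real by fastforce
qed

text \<open>\<open>z\<close> is the maximizer at \<open>q\<close>; as a competitor at
  \<open>q'\<close> it gives the affine minorant. For the upper bound the maximizer \<open>x\<close>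
  at \<open>q'\<close> is tested at \<open>q\<close>, where it loses at least
  \<open>\<rho> / 2 * (norm (x - z))\<^sup>2\<close>.\<close>

lemma smoothed_conjugate_quadratic_bounds:
  fixes f :: "'a::euclidean_space \<Rightarrow> ereal"
  assumes f: "proper_fun f" "convex_fun f" "lsc_fun f" "bounded (effective_domain f)"
    and "\<rho> > 0"
  shows "\<exists>z. \<forall>q'. rconj \<rho> f q + z \<bullet> (q' - q) \<le> rconj \<rho> f q' \<and>
    rconj \<rho> f q' \<le> rconj \<rho> f q + z \<bullet> (q' - q) + (norm (q' - q))\<^sup>2 / (2 * \<rho>)"
proof -
  obtain z where z: "z \<in> effective_domain f"
    "smoothed_conjugate \<rho> f q = ereal (q \<bullet> z - real_of_ereal (f z) - \<rho> / 2 * (norm z)\<^sup>2)"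
    using smoothed_conjugate_attained[OF f(1,3,4)] .
  show ?thesis
  proof (intro exI allI conjI)
    fix q'
    show "rconj \<rho> f q + z \<bullet> (q' - q) \<le> rconj \<rho> f q'"
      using smoothed_conjugate_ge[OF f(1,3,4) z(1), of q' \<rho>] z(2)
      by (simp add: inner_diff inner_commute)
    obtain x where x: "x \<in> effective_domain f"
      "smoothed_conjugate \<rho> f q' = ereal (q' \<bullet> x - real_of_ereal (f x) - \<rho> / 2 * (norm x)\<^sup>2)"
      using smoothed_conjugate_attained[OF f(1,3,4)] .
    \<comment> \<open>Young's inequality by completing the square: the loss at \<open>q\<close>
      absorbs the cross term \<open>(x - z) \<bullet> (q' - q)\<close> up to the stated
      remainder.\<close>
    have "0 \<le> (norm (q' - q - \<rho> *\<^sub>R (x - z)))\<^sup>2 / (2 * \<rho>)"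
      using assms by simp
    also have "\<dots> = \<rho> / 2 * (norm (x - z))\<^sup>2 - (x - z) \<bullet> (q' - q) + (norm (q' - q))\<^sup>2 / (2 * \<rho>)"
      using assms(5) unfolding norm_diff_sq_scaleR
      by (simp add: diff_divide_distrib add_divide_distrib power2_eq_square)
    finally show "rconj \<rho> f q' \<le> rconj \<rho> f q + z \<bullet> (q' - q) + (norm (q' - q))\<^sup>2 / (2 * \<rho>)"
      using smoothed_conjugate_strong_max[OF f z(1) _ x(1), of \<rho> q] z(2) x(2)
      by (simp add: inner_diff inner_commute algebra_simps)
  qed
qed

section \<open>The fast gradient method\<close>

lemma norm_convex_combination_sq_le:
  fixes x y :: "'a::real_inner"
  assumes "0 \<le> t" "t \<le> 1"
  shows "(norm ((1 - t) *\<^sub>R x + t *\<^sub>R y))\<^sup>2 \<le> (1 - t) * (norm x)\<^sup>2 + t * (norm y)\<^sup>2"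
  unfolding norm_convex_combination_sq using assms by simp

text \<open>\<open>z\<close> is arbitrary, not a minimizer.  The point \<open>v\<close> is the centre of Nesterov's estimate
  function, recovered from the iterates by \<open>v = w + (w - p) / q\<close>.\<close>
lemma fast_gradient_step:
  fixes F :: "'a::real_inner \<Rightarrow> real" and G p v w z :: 'a
  assumes upper: "\<And>y. F y \<le> F w + G \<bullet> (y - w) + L / 2 * (norm (y - w))\<^sup>2"
    and lower: "\<And>y. F w + G \<bullet> (y - w) + \<kappa> / 2 * (norm (y - w))\<^sup>2 \<le> F y"
    and "0 < \<kappa>" "\<kappa> \<le> L" and q: "q = sqrt (\<kappa> / L)"
    and w: "p = w - q *\<^sub>R (v - w)"
  defines "v' \<equiv> (1 - q) *\<^sub>R v + q *\<^sub>R w - (q / \<kappa>) *\<^sub>R G"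
  shows "F (w - (1 / L) *\<^sub>R G) - F z + \<kappa> / 2 * (norm (v' - z))\<^sup>2
    \<le> (1 - q) * (F p - F z + \<kappa> / 2 * (norm (v - z))\<^sup>2)"
proof -
  have L: "L > 0" using assms by simp
  have q01: "0 < q" "q \<le> 1" using assms L by simp_all
  have qq: "q\<^sup>2 = \<kappa> / L" using assms L by simp
  let ?u = "(1 - q) *\<^sub>R (v - z) + q *\<^sub>R (w - z)"
  \<comment> \<open>The step \<open>1 / L\<close> minimizes the quadratic upper model and gains
    \<open>(norm G)\<^sup>2 / (2 * L)\<close>.\<close>
  have "F (w - (1 / L) *\<^sub>R G) \<le> F w + G \<bullet> (- (1 / L) *\<^sub>R G) + L / 2 * (norm (- (1 / L) *\<^sub>R G))\<^sup>2"
    using upper[of "w - (1 / L) *\<^sub>R G"] by simp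
  also have "\<dots> = F w - (norm G)\<^sup>2 / (2 * L)"
    using L by (simp add: power_mult_distrib dot_square_norm field_simps power2_eq_square)
  finally have 1: "F (w - (1 / L) *\<^sub>R G) \<le> F w - (norm G)\<^sup>2 / (2 * L)" .
  \<comment> \<open>The weights \<open>q\<close> and \<open>1 - q\<close> split \<open>F w\<close>
    into a part compared with \<open>z\<close>, keeping the curvature term, and a part compared with
    \<open>p\<close>, dropping it.\<close>
  have 2: "q * (F w + G \<bullet> (z - w) + \<kappa> / 2 * (norm (w - z))\<^sup>2) \<le> q * F z"
    using lower[of z] q01 by (intro mult_left_mono) (auto simp: norm_minus_commute)
  have "F w + G \<bullet> (p - w) \<le> F p"
    using lower[of p] assms(3) by (smt (verit) divide_nonneg_nonneg mult_nonneg_nonneg zero_le_power2)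
  then have 3: "(1 - q) * (F w + G \<bullet> (p - w)) \<le> (1 - q) * F p"
    using q01 by (intro mult_left_mono) auto
  have "v' - z = ?u - (q / \<kappa>) *\<^sub>R G"
    by (simp add: v'_def algebra_simps)
  then have "(norm (v' - z))\<^sup>2 = (norm ?u)\<^sup>2 - 2 * (q / \<kappa>) * (G \<bullet> ?u) + (q / \<kappa>)\<^sup>2 * (norm G)\<^sup>2"
    by (simp only: norm_diff_sq_scaleR)
  then have "\<kappa> / 2 * (norm (v' - z))\<^sup>2
      = \<kappa> / 2 * (norm ?u)\<^sup>2 - q * (G \<bullet> ?u) + q\<^sup>2 / (2 * \<kappa>) * (norm G)\<^sup>2"
    using assms(3) by (simp add: field_simps power2_eq_square)
  \<comment> \<open>This fixes the choice \<open>q = sqrt (\<kappa> / L)\<close>: the gradient term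
    produced by moving \<open>v\<close> equals the descent gain and cancels against it.\<close>
  also have "q\<^sup>2 / (2 * \<kappa>) * (norm G)\<^sup>2 = (norm G)\<^sup>2 / (2 * L)"
    using assms(3) L unfolding qq by (simp add: field_simps)
  finally have 4: "\<kappa> / 2 * (norm (v' - z))\<^sup>2
      = \<kappa> / 2 * (norm ?u)\<^sup>2 - q * (G \<bullet> ?u) + (norm G)\<^sup>2 / (2 * L)" .
  have 5: "\<kappa> / 2 * (norm ?u)\<^sup>2 \<le> \<kappa> / 2 * ((1 - q) * (norm (v - z))\<^sup>2 + q * (norm (w - z))\<^sup>2)"
    using norm_convex_combination_sq_le[of q "v - z" "w - z"] q01 assms(3)
    by (intro mult_left_mono) auto
  \<comment> \<open>Since \<open>q *\<^sub>R (v - w) = w - p\<close>, the vector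
    \<open>q *\<^sub>R ?u\<close> is \<open>q *\<^sub>R (w - z) + (1 - q) *\<^sub>R (w - p)\<close>;
    so the linear terms of facts 2 and 3 cancel.\<close>
  have 6: "q * (G \<bullet> ?u) = - (q * (G \<bullet> (z - w))) - (1 - q) * (G \<bullet> (p - w))"
    unfolding w by (simp add: inner_diff inner_add algebra_simps)
  show ?thesis
    using 1 2 3 4 5 6
    unfolding left_diff_distrib right_diff_distrib distrib_left distrib_right mult_1_left
      mult.left_commute[of q "\<kappa> / 2"]
    by linarith
qed

text \<open>Induction on the contraction of \<open>fast_gradient_step\<close>, started at
  \<open>v 0 = 0\<close>; the nonnegative distance term is dropped at the end. The two bounds force
  \<open>G\<close> to be the gradient, hence the field that the iteration uses.\<close>

theorem fast_gradient_rate: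
  fixes F :: "'a::real_inner \<Rightarrow> real"
  assumes upper: "\<And>x y. F y \<le> F x + G x \<bullet> (y - x) + L / 2 * (norm (y - x))\<^sup>2"
    and lower: "\<And>x y. F x + G x \<bullet> (y - x) + \<kappa> / 2 * (norm (y - x))\<^sup>2 \<le> F y"
    and "0 < \<kappa>" "\<kappa> \<le> L"
  shows "F (fst (fast_gradient F L \<kappa> k)) - F z
    \<le> (1 - sqrt (\<kappa> / L)) ^ k * (F 0 - F z + \<kappa> / 2 * (norm z)\<^sup>2)"
proof -
  define q where "q = sqrt (\<kappa> / L)"
  have L: "L > 0" using assms by simp
  have q01: "0 < q" "q \<le> 1" using assms L by (simp_all add: q_def)
  have qq: "q * q = \<kappa> / L" using assms L by (simp add: q_def)
  have grad: "gradient F x = G x" for x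
  proof (rule gradient_eq, rule GDERIV_of_quadratic_error)
    fix y
    have "0 \<le> \<kappa> / 2 * (norm (y - x))\<^sup>2" using assms by simp
    then show "\<bar>F y - F x - G x \<bullet> (y - x)\<bar> \<le> L / 2 * (norm (y - x))\<^sup>2"
      using upper[of y x] lower[of x y] by simp
  qed
  define p where "p k = fst (fast_gradient F L \<kappa> k)" for k
  define w where "w k = snd (fast_gradient F L \<kappa> k)" for k
  define v where "v k = w k + (1 / q) *\<^sub>R (w k - p k)" for k
  have "sqrt \<kappa> = q * sqrt L" using L by (simp add: q_def real_sqrt_divide)
  then have \<beta>: "(sqrt L - sqrt \<kappa>) / (sqrt L + sqrt \<kappa>) = (1 - q) / (1 + q)"
    using L q01 mult_divide_mult_cancel_right[of "sqrt L" "1 - q" "1 + q"]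
    by (simp add: algebra_simps)
  have p0: "p 0 = 0" "v 0 = 0" by (simp_all add: p_def w_def v_def)
  have pS: "p (Suc k) = w k - (1 / L) *\<^sub>R G (w k)" for k
    by (simp add: p_def w_def Let_def grad)
  have wS: "w (Suc k) = p (Suc k) + ((1 - q) / (1 + q)) *\<^sub>R (p (Suc k) - p k)" for k
    by (simp add: p_def w_def Let_def grad \<beta>)
  \<comment> \<open>The momentum coefficient is the one for which \<open>v\<close>, defined from the
    iterates, obeys the update of the estimate-function centre. Multiplying by \<open>q\<close>
    clears the quotient in its definition.\<close>
  have vS: "v (Suc k) = (1 - q) *\<^sub>R v k + q *\<^sub>R w k - (q / \<kappa>) *\<^sub>R G (w k)" for k
  proof -
    have "q *\<^sub>R v (Suc k) = (q + 1) *\<^sub>R (w (Suc k) - p (Suc k)) + q *\<^sub>R p (Suc k)"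
      using q01 by (simp add: v_def algebra_simps)
    also have "\<dots> = (1 - q) *\<^sub>R (p (Suc k) - p k) + q *\<^sub>R p (Suc k)"
      using q01 by (simp add: wS add.commute)
    also have "\<dots> = p (Suc k) - (1 - q) *\<^sub>R p k"
      by (simp add: algebra_simps)
    also have "\<dots> = w k - (1 / L) *\<^sub>R G (w k) - (1 - q) *\<^sub>R p k"
      by (simp add: pS)
    also have "\<dots> = q *\<^sub>R ((1 - q) *\<^sub>R v k + q *\<^sub>R w k - (q / \<kappa>) *\<^sub>R G (w k))"
    proof -
      have "q * (q / \<kappa>) = 1 / L" using qq assms(3) by (simp add: field_simps)
      moreover have "q *\<^sub>R v k = (1 + q) *\<^sub>R w k - p k"
        using q01 by (simp add: v_def algebra_simps)
      ultimately show ?thesis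
        by (simp add: scaleR_right_diff_distrib scaleR_add_right scaleR_left_commute[of q "1 - q"]
            del: scaleR_scaleR)
           (simp add: algebra_simps)
    qed
    finally show ?thesis using q01 by (simp only: scaleR_cancel_left) simp
  qed
  have "F (p k) - F z + \<kappa> / 2 * (norm (v k - z))\<^sup>2
      \<le> (1 - q) ^ k * (F 0 - F z + \<kappa> / 2 * (norm z)\<^sup>2)"
  proof (induction k)
    case (Suc k)
    have "p k = w k - q *\<^sub>R (v k - w k)" using q01 by (simp add: v_def)
    from fast_gradient_step[OF upper lower assms(3,4) q_def this, of z]
    have "F (p (Suc k)) - F z + \<kappa> / 2 * (norm (v (Suc k) - z))\<^sup>2
        \<le> (1 - q) * (F (p k) - F z + \<kappa> / 2 * (norm (v k - z))\<^sup>2)"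
      by (simp only: pS vS)
    also have "\<dots> \<le> (1 - q) * ((1 - q) ^ k * (F 0 - F z + \<kappa> / 2 * (norm z)\<^sup>2))"
      using Suc q01 by (intro mult_left_mono) auto
    finally show ?case by (simp add: mult.assoc)
  qed (simp add: p0)
  moreover have "0 \<le> \<kappa> / 2 * (norm (v k - z))\<^sup>2" using assms by simp
  ultimately show ?thesis by (simp add: p_def q_def)
qed

section \<open>Double smoothing of the dual\<close>

lemma doubly_smoothed_theta_eq:
  fixes f :: "'a::euclidean_space \<Rightarrow> ereal" and g :: "'b::euclidean_space \<Rightarrow> ereal"
  assumes "proper_fun f" "lsc_fun f" "bounded (effective_domain f)"
    and "proper_fun g" "lsc_fun g" "bounded (effective_domain g)"
  shows "doubly_smoothed_theta f g A \<rho> \<mu> \<kappa> q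
    = ereal (rconj \<rho> f (adjoint A q) + rconj \<mu> g (- q) + \<kappa> / 2 * (norm q)\<^sup>2)"
  unfolding doubly_smoothed_theta_def smoothed_theta_def
  by (subst smoothed_conjugate_finite[OF assms(1-3)], subst smoothed_conjugate_finite[OF assms(4-6)]) simp

text \<open>\<open>G\<close> is the chain-rule gradient, with \<open>Z\<close> and \<open>Y\<close>
  the slopes of the two smoothed conjugates. Their lower bounds are affine, so the curvature
  \<kappa> below comes from the quadratic term alone, while above all three contributions add up to
  \<open>L\<close>.\<close>

lemma doubly_smoothed_theta_quadratic_bounds:
  fixes f :: "'a::euclidean_space \<Rightarrow> ereal" and g :: "'b::euclidean_space \<Rightarrow> ereal"
    and \<kappa> :: real
  assumes f: "proper_fun f" "convex_fun f" "lsc_fun f" "bounded (effective_domain f)"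
    and g: "proper_fun g" "convex_fun g" "lsc_fun g" "bounded (effective_domain g)"
    and A: "linear A" and pos: "\<rho> > 0" "\<mu> > 0"
  defines "F \<equiv> \<lambda>q. real_of_ereal (doubly_smoothed_theta f g A \<rho> \<mu> \<kappa> q)"
    and "L \<equiv> (onorm A)\<^sup>2 / \<rho> + 1 / \<mu> + \<kappa>"
  obtains G where "\<And>x y. F y \<le> F x + G x \<bullet> (y - x) + L / 2 * (norm (y - x))\<^sup>2"
    "\<And>x y. F x + G x \<bullet> (y - x) + \<kappa> / 2 * (norm (y - x))\<^sup>2 \<le> F y"
proof -
  have F: "F q = rconj \<rho> f (adjoint A q) + rconj \<mu> g (- q) + \<kappa> / 2 * (norm q)\<^sup>2" for q
    by (simp add: F_def doubly_smoothed_theta_eq[OF f(1,3,4) g(1,3,4)])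
  obtain Z where Z: "\<And>q q'. rconj \<rho> f q + Z q \<bullet> (q' - q) \<le> rconj \<rho> f q' \<and>
      rconj \<rho> f q' \<le> rconj \<rho> f q + Z q \<bullet> (q' - q) + (norm (q' - q))\<^sup>2 / (2 * \<rho>)"
    using smoothed_conjugate_quadratic_bounds[OF f pos(1)] by metis
  obtain Y where Y: "\<And>q q'. rconj \<mu> g q + Y q \<bullet> (q' - q) \<le> rconj \<mu> g q' \<and>
      rconj \<mu> g q' \<le> rconj \<mu> g q + Y q \<bullet> (q' - q) + (norm (q' - q))\<^sup>2 / (2 * \<mu>)"
    using smoothed_conjugate_quadratic_bounds[OF g pos(2)] by metis
  define G where "G x = A (Z (adjoint A x)) - Y (- x) + \<kappa> *\<^sub>R x" for x
  have G: "G x \<bullet> (y - x) = Z (adjoint A x) \<bullet> (adjoint A y - adjoint A x) + Y (- x) \<bullet> (- y - - x)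
      + \<kappa> / 2 * (norm y)\<^sup>2 - \<kappa> / 2 * (norm x)\<^sup>2 - \<kappa> / 2 * (norm (y - x))\<^sup>2" for x y
    unfolding G_def power2_norm_eq_inner
    by (simp add: inner_diff inner_add adjoint_works[OF A] inner_commute[of y x] algebra_simps)
  have "(norm (adjoint A y - adjoint A x))\<^sup>2 / (2 * \<rho>) \<le> (onorm A)\<^sup>2 / \<rho> / 2 * (norm (y - x))\<^sup>2" for x y
  proof -
    have "norm (adjoint A y - adjoint A x) \<le> onorm A * norm (y - x)"
      using onorm_adjoint_bound[OF A, of "y - x"] by (simp add: linear_diff adjoint_linear[OF A])
    then have "(norm (adjoint A y - adjoint A x))\<^sup>2 \<le> (onorm A)\<^sup>2 * (norm (y - x))\<^sup>2"
      by (simp add: power_mono flip: power_mult_distrib)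
    then show ?thesis using pos by (simp add: field_simps)
  qed
  moreover have "(norm (- y - - x))\<^sup>2 / (2 * \<mu>) = 1 / \<mu> / 2 * (norm (y - x))\<^sup>2" for x y :: 'b
    by (simp add: norm_minus_commute)
  moreover have "L / 2 * (norm (y - x))\<^sup>2 = (onorm A)\<^sup>2 / \<rho> / 2 * (norm (y - x))\<^sup>2
      + 1 / \<mu> / 2 * (norm (y - x))\<^sup>2 + \<kappa> / 2 * (norm (y - x))\<^sup>2" for x y :: 'b
    unfolding L_def by (simp add: add_divide_distrib distrib_right)
  ultimately have "F y \<le> F x + G x \<bullet> (y - x) + L / 2 * (norm (y - x))\<^sup>2" for x y
    using Z[of "adjoint A x" "adjoint A y"] Y[of "- x" "- y"] G[of x y]
    unfolding F by smt
  moreover have "F x + G x \<bullet> (y - x) + \<kappa> / 2 * (norm (y - x))\<^sup>2 \<le> F y" for x y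
    using Z[of "adjoint A x" "adjoint A y"] Y[of "- x" "- y"] G[of x y]
    unfolding F by linarith
  ultimately show thesis by (rule that)
qed

section \<open>The unsmoothed dual objective\<close>

lemma dual_theta_eq:
  fixes f :: "'a::euclidean_space \<Rightarrow> ereal" and g :: "'b::euclidean_space \<Rightarrow> ereal"
  assumes "proper_fun f" "lsc_fun f" "bounded (effective_domain f)"
    and "proper_fun g" "lsc_fun g" "bounded (effective_domain g)"
  shows "dual_theta f g A q = ereal (rconj 0 f (adjoint A q) + rconj 0 g (- q))"
  unfolding dual_theta_def conjugate_eq_smoothed_conjugate
  by (subst smoothed_conjugate_finite[OF assms(1-3)], subst smoothed_conjugate_finite[OF assms(4-6)]) simp

text \<open>By finiteness, negation distributes over the extended sum, so the dual objective is
  \<open>- dual_theta f g A\<close> and maximizing it means minimizing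
  \<open>dual_theta f g A\<close>.\<close>

lemma dual_solution_theta:
  fixes f :: "'a::euclidean_space \<Rightarrow> ereal" and g :: "'b::euclidean_space \<Rightarrow> ereal"
  assumes fg: "proper_fun f" "lsc_fun f" "bounded (effective_domain f)"
      "proper_fun g" "lsc_fun g" "bounded (effective_domain g)"
    and sol: "dual_solution f g A p"
  shows "dual_value f g A = - dual_theta f g A p" "dual_theta f g A p \<le> dual_theta f g A q"
proof -
  have neg: "- conjugate f (adjoint A q) - conjugate g (- q) = - dual_theta f g A q" for q
    unfolding dual_theta_def conjugate_eq_smoothed_conjugate
    by (subst (1 2) smoothed_conjugate_finite[OF fg(1-3)],
        subst (1 2) smoothed_conjugate_finite[OF fg(4-6)]) simp
  show "dual_value f g A = - dual_theta f g A p"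
    using sol unfolding dual_solution_def neg by simp
  moreover have "- dual_theta f g A q \<le> dual_value f g A"
    unfolding dual_value_def neg by (rule SUP_upper) simp
  ultimately show "dual_theta f g A p \<le> dual_theta f g A q" by simp
qed

section \<open>Accuracy and number of iterations\<close>

lemma geometric_decay_threshold:
  assumes q: "0 < q" "q \<le> 1" and "0 < \<epsilon>" "\<epsilon> / 2 \<le> M"
    and k: "2 / q * ln (25 * M / (2 * \<epsilon>)) \<le> real k"
  shows "(1 - q) ^ k * M \<le> \<epsilon> / 4"
proof -
  define T where "T = 25 * M / (2 * \<epsilon>)"
  \<comment> \<open>\<open>\<epsilon> / 2 \<le> M\<close> even gives \<open>T \<ge> 25 / 4\<close>;
    hence \<open>ln T\<close> is nonnegative and \<open>ln T \<le> 2 * ln T\<close>.\<close>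
  have T: "T \<ge> 1" using assms by (simp add: T_def field_simps)
  have "ln T \<le> 2 * ln T" using T by simp
  also have "\<dots> \<le> q * real k"
    using k q unfolding T_def[symmetric] by (simp add: field_simps)
  finally have lnT: "ln T \<le> q * real k" .
  have "(1 - q) ^ k \<le> exp (- q) ^ k"
    using q exp_ge_add_one_self[of "- q"] by (intro power_mono) auto
  also have "\<dots> = exp (- (q * real k))" by (simp add: exp_of_nat_mult[symmetric] mult.commute)
  also have "\<dots> \<le> exp (- ln T)" using lnT by simp
  also have "\<dots> = 1 / T" using T by (simp add: exp_minus inverse_eq_divide)
  \<comment> \<open>The constant 25/2 inside the logarithm makes \<open>M / T\<close> equal to
    \<open>2 * \<epsilon> / 25\<close>, below the allotted quarter of \<epsilon>.\<close>
  finally have "(1 - q) ^ k * M \<le> 1 / T * M" using assms by (intro mult_right_mono) auto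
  also have "\<dots> = 2 * \<epsilon> / 25" using assms by (simp add: T_def)
  also have "\<dots> \<le> \<epsilon> / 4" using assms by simp
  finally show ?thesis .
qed

lemma double_smoothing_accuracy:
  fixes f :: "'a::euclidean_space \<Rightarrow> ereal" and g :: "'b::euclidean_space \<Rightarrow> ereal"
  assumes f: "proper_fun f" "convex_fun f" "lsc_fun f" "bounded (effective_domain f)"
    and g: "proper_fun g" "convex_fun g" "lsc_fun g" "bounded (effective_domain g)"
    and A: "linear A"
    and p: "dual_solution f g A p" "R > 0" "norm p \<le> R"
    and D: "domain_bound f > 0" "domain_bound g > 0" and \<epsilon>: "\<epsilon> > 0"
  defines "\<rho> \<equiv> \<epsilon> / (4 * domain_bound f)" and "\<mu> \<equiv> \<epsilon> / (4 * domain_bound g)"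
    and "\<kappa> \<equiv> \<epsilon> / (2 * R\<^sup>2)"
  defines "L \<equiv> (onorm A)\<^sup>2 / \<rho> + 1 / \<mu> + \<kappa>"
    and "\<Theta> \<equiv> \<lambda>q. real_of_ereal (dual_theta f g A q)"
  assumes k: "2 * sqrt (L / \<kappa>) * ln (25 * (\<Theta> 0 - \<Theta> p + \<epsilon> / 2) / (2 * \<epsilon>)) \<le> real k"
  shows "dual_theta f g A (fst (fast_gradient
      (\<lambda>q. real_of_ereal (doubly_smoothed_theta f g A \<rho> \<mu> \<kappa> q)) L \<kappa> k)) + dual_value f g A \<le> ereal \<epsilon>"
proof -
  define F where "F q = real_of_ereal (doubly_smoothed_theta f g A \<rho> \<mu> \<kappa> q)" for q
  define r where "r = fst (fast_gradient F L \<kappa> k)"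
  define M where "M = \<Theta> 0 - \<Theta> p + \<epsilon> / 2"
  have pos: "\<rho> > 0" "\<mu> > 0" "\<kappa> > 0" using \<epsilon> D p(2) by (simp_all add: \<rho>_def \<mu>_def \<kappa>_def)
  have L: "\<kappa> \<le> L" "0 < L" using pos by (simp_all add: L_def add_nonneg_pos)
  note fg = f(1,3,4) g(1,3,4)
  have \<Theta>: "dual_theta f g A q = ereal (\<Theta> q)" for q
    by (simp add: \<Theta>_def dual_theta_eq[OF fg])
  have \<Theta>': "\<Theta> q = rconj 0 f (adjoint A q) + rconj 0 g (- q)" for q
    by (simp add: \<Theta>_def dual_theta_eq[OF fg])
  have F: "F q = rconj \<rho> f (adjoint A q) + rconj \<mu> g (- q) + \<kappa> / 2 * (norm q)\<^sup>2" for q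
    by (simp add: F_def doubly_smoothed_theta_eq[OF f(1,3,4) g(1,3,4)])
  have F_le: "F q - \<kappa> / 2 * (norm q)\<^sup>2 \<le> \<Theta> q" for q
    using smoothed_conjugate_antimono[OF f(1,3,4), of \<rho> "adjoint A q"]
      smoothed_conjugate_antimono[OF g(1,3,4), of \<mu> "- q"] pos by (simp add: F \<Theta>')
  have "\<rho> * domain_bound f = \<epsilon> / 4" "\<mu> * domain_bound g = \<epsilon> / 4"
    using D by (simp_all add: \<rho>_def \<mu>_def)
  then have le_F: "\<Theta> q \<le> F q - \<kappa> / 2 * (norm q)\<^sup>2 + \<epsilon> / 2" for q
    using smoothed_conjugate_error[OF f(1,3,4), of \<rho> "adjoint A q"]
      smoothed_conjugate_error[OF g(1,3,4), of \<mu> "- q"] pos by (simp add: F \<Theta>')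
  obtain G where G: "\<And>x y. F y \<le> F x + G x \<bullet> (y - x) + L / 2 * (norm (y - x))\<^sup>2"
    "\<And>x y. F x + G x \<bullet> (y - x) + \<kappa> / 2 * (norm (y - x))\<^sup>2 \<le> F y"
    using doubly_smoothed_theta_quadratic_bounds[OF f g A pos(1,2), of \<kappa>]
    unfolding F_def L_def by metis
  define q where "q = sqrt (\<kappa> / L)"
  have q: "0 < q" "q \<le> 1" using pos L by (simp_all add: q_def)
  have "\<Theta> p \<le> \<Theta> 0" using dual_solution_theta(2)[OF fg p(1), of 0] by (simp add: \<Theta>)
  then have M: "\<epsilon> / 2 \<le> M" by (simp add: M_def)
  have "sqrt (L / \<kappa>) = 1 / q" by (simp add: q_def real_sqrt_divide)
  with k have k': "2 / q * ln (25 * M / (2 * \<epsilon>)) \<le> real k" by (simp add: M_def)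
  have "F r - F p \<le> (1 - q) ^ k * (F 0 - F p + \<kappa> / 2 * (norm p)\<^sup>2)"
    unfolding r_def q_def by (rule fast_gradient_rate[OF G pos(3) L(1)])
  \<comment> \<open>At 0 the quadratic term vanishes and smoothing only lowers the value; at
    \<open>p\<close> smoothing costs at most \<open>\<epsilon> / 2\<close>, and the \<kappa> term of
    \<open>F p\<close> cancels the added one. Hence the \<open>\<epsilon> / 2\<close> in
    \<open>M\<close>.\<close>
  also have "\<dots> \<le> (1 - q) ^ k * M"
    using F_le[of 0] le_F[of p] q by (intro mult_left_mono) (auto simp: M_def)
  also have "\<dots> \<le> \<epsilon> / 4" by (rule geometric_decay_threshold[OF q \<epsilon> M k'])
  finally have "F r - F p \<le> \<epsilon> / 4" .
  moreover have "\<kappa> / 2 * (norm p)\<^sup>2 \<le> \<epsilon> / 4"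
  proof -
    have "\<kappa> / 2 * (norm p)\<^sup>2 \<le> \<kappa> / 2 * R\<^sup>2"
      using p pos by (intro mult_left_mono power_mono) auto
    also have "\<dots> = \<epsilon> / 4" using p by (simp add: \<kappa>_def)
    finally show ?thesis .
  qed
  moreover have "0 \<le> \<kappa> / 2 * (norm r)\<^sup>2" using pos by simp
  \<comment> \<open>The budget: \<open>\<epsilon> / 2\<close> for returning from \<open>F r\<close>
    to \<open>\<Theta> r\<close>, \<open>\<epsilon> / 4\<close> for the iteration,
    \<open>\<epsilon> / 4\<close> for the quadratic term at \<open>p\<close>.\<close>
  ultimately have "\<Theta> r - \<Theta> p \<le> \<epsilon>" using le_F[of r] F_le[of p] by linarith
  then show ?thesis
    using dual_solution_theta(1)[OF fg p(1)] unfolding r_def F_def \<Theta> by simp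
qed

lemma iteration_count_bigo:
  assumes "b \<ge> 0" "\<Delta> \<ge> 0"
  shows "(\<lambda>\<epsilon>. real (nat \<lceil>2 * sqrt (1 + b / \<epsilon>\<^sup>2) * ln (25 * (\<Delta> + \<epsilon> / 2) / (2 * \<epsilon>))\<rceil>))
    \<in> O[at_right 0](\<lambda>\<epsilon>. 1 / \<epsilon> * ln (1 / \<epsilon>))"
proof -
  define C where "C = 25 * (\<Delta> + 1) / 2"
  \<comment> \<open>The final \<open>+ 1\<close> pays for rounding up to an integer.\<close>
  define K where "K = 2 * sqrt (1 + b) * (ln C + 1) + 1"
  have C: "C \<ge> 1" using assms by (simp add: C_def)
  have bound: "real (nat \<lceil>2 * sqrt (1 + b / \<epsilon>\<^sup>2) * ln (25 * (\<Delta> + \<epsilon> / 2) / (2 * \<epsilon>))\<rceil>)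
      \<le> K * (1 / \<epsilon> * ln (1 / \<epsilon>)) \<and> 0 \<le> 1 / \<epsilon> * ln (1 / \<epsilon>)"
    if \<epsilon>: "0 < \<epsilon>" "\<epsilon> < exp (- 1)" for \<epsilon>
  proof -
    define l where "l = ln (1 / \<epsilon>)"
    have "ln \<epsilon> < - 1" using \<epsilon> by (metis ln_exp ln_less_cancel_iff exp_gt_zero)
    \<comment> \<open>The reason for keeping \<epsilon> below \<open>exp (- 1)\<close>: with
      \<open>l \<ge> 1\<close> the constant \<open>ln C\<close> is absorbed into a multiple of
      \<open>l\<close>, and the rounding error 1 into \<open>1 / \<epsilon> * l\<close>.\<close>
    then have l: "l \<ge> 1" using \<epsilon> by (simp add: l_def ln_div)
    have \<epsilon>1: "\<epsilon> < 1" using \<epsilon> by (smt (verit) exp_le_one_iff)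
    let ?T = "25 * (\<Delta> + \<epsilon> / 2) / (2 * \<epsilon>)"
    have T1: "1 \<le> ?T" using \<epsilon> assms by (simp add: field_simps)
    have "?T \<le> C / \<epsilon>" using \<epsilon> \<epsilon>1 by (simp add: C_def field_simps)
    then have "ln ?T \<le> ln (C / \<epsilon>)" using T1 by (subst ln_le_cancel_iff) auto
    also have "\<dots> = ln C + l" using C \<epsilon> by (simp add: l_def ln_div)
    also have "\<dots> \<le> (ln C + 1) * l"
      using mult_left_mono[OF l, of "ln C"] C by (simp add: distrib_right)
    finally have lnT: "ln ?T \<le> (ln C + 1) * l" .
    have "1 \<le> 1 / \<epsilon>\<^sup>2" using \<epsilon> \<epsilon>1 by (simp add: power_le_one)
    then have "sqrt (1 + b / \<epsilon>\<^sup>2) \<le> sqrt ((1 + b) / \<epsilon>\<^sup>2)"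
      by (intro real_sqrt_le_mono) (simp add: add_divide_distrib)
    also have "\<dots> = sqrt (1 + b) / \<epsilon>" using \<epsilon> by (simp add: real_sqrt_divide)
    finally have s: "sqrt (1 + b / \<epsilon>\<^sup>2) \<le> sqrt (1 + b) / \<epsilon>" .
    have "2 * sqrt (1 + b / \<epsilon>\<^sup>2) * ln ?T \<le> 2 * (sqrt (1 + b) / \<epsilon>) * ((ln C + 1) * l)"
      using s lnT T1 assms \<epsilon> by (intro mult_mono) auto
    moreover have "0 \<le> 2 * sqrt (1 + b / \<epsilon>\<^sup>2) * ln ?T" using T1 assms by simp
    moreover have "1 * 1 \<le> 1 / \<epsilon> * l" using \<epsilon> \<epsilon>1 l by (intro mult_mono) auto
    moreover have "K * (1 / \<epsilon> * l) = 2 * (sqrt (1 + b) / \<epsilon>) * ((ln C + 1) * l) + 1 / \<epsilon> * l"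
      using \<epsilon> by (simp add: K_def field_simps)
    ultimately show ?thesis unfolding l_def[symmetric] by linarith
  qed
  have "\<forall>\<^sub>F \<epsilon> :: real in at_right 0. 0 < \<epsilon> \<and> \<epsilon> < exp (- 1)"
    unfolding eventually_at_right_field by (intro exI[of _ "exp (- 1)"]) simp
  then have "\<forall>\<^sub>F \<epsilon> in at_right 0. norm (real (nat \<lceil>2 * sqrt (1 + b / \<epsilon>\<^sup>2) * ln (25 * (\<Delta> + \<epsilon> / 2) / (2 * \<epsilon>))\<rceil>))
      \<le> K * norm (1 / \<epsilon> * ln (1 / \<epsilon>))"
  proof eventually_elim
    case (elim \<epsilon>)
    with bound[of \<epsilon>] show ?case
      by (simp only: real_norm_def abs_of_nonneg of_nat_0_le_iff)
  qed
  then show ?thesis by (rule bigoI)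
qed

theorem mainTheorem1:
  fixes f :: "real ^ 'n \<Rightarrow> ereal" and g :: "real ^ 'm \<Rightarrow> ereal"
    and A :: "real ^ 'n \<Rightarrow> real ^ 'm"
    and pstar :: "real ^ 'm" and R Df Dg :: real
    and \<theta> :: "real ^ 'm \<Rightarrow> ereal"
    and \<rho> \<mu> \<kappa> L threshold :: "real \<Rightarrow> real"
    and p :: "real \<Rightarrow> nat \<Rightarrow> real ^ 'm"
  assumes f: "proper_fun f" "convex_fun f" "lsc_fun f" "bounded (effective_domain f)"
    and g: "proper_fun g" "convex_fun g" "lsc_fun g" "bounded (effective_domain g)"
    and A: "linear A" "A ` effective_domain f \<inter> effective_domain g \<noteq> {}"
    and pstar: "dual_solution f g A pstar" "R > 0" "norm pstar \<le> R"
    and Df_pos: "domain_bound f > 0" and Dg_pos: "domain_bound g > 0"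
  defines "Df \<equiv> domain_bound f"
    and "Dg \<equiv> domain_bound g"
    and "\<theta> \<equiv> dual_theta f g A"
    and "\<rho> \<equiv> \<lambda>\<epsilon>. \<epsilon> / (4 * Df)"
    and "\<mu> \<equiv> \<lambda>\<epsilon>. \<epsilon> / (4 * Dg)"
    and "\<kappa> \<equiv> \<lambda>\<epsilon>. \<epsilon> / (2 * R\<^sup>2)"
    and "L \<equiv> \<lambda>\<epsilon>. (onorm A)\<^sup>2 / \<rho> \<epsilon> + 1 / \<mu> \<epsilon> + \<kappa> \<epsilon>"
    and "p \<equiv> \<lambda>\<epsilon> k. fst (fast_gradient
            (\<lambda>q. real_of_ereal (doubly_smoothed_theta f g A (\<rho> \<epsilon>) (\<mu> \<epsilon>) (\<kappa> \<epsilon>) q))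
            (L \<epsilon>) (\<kappa> \<epsilon>) k)"
    and "threshold \<equiv> \<lambda>\<epsilon>. 2 * sqrt (L \<epsilon> / \<kappa> \<epsilon>) *
            ln (25 * (real_of_ereal (\<theta> 0) - real_of_ereal (\<theta> pstar) + \<epsilon> / 2) / (2 * \<epsilon>))"
  shows "(\<forall>\<epsilon>>0.
            (\<forall>k::nat. real k \<ge> threshold \<epsilon> \<longrightarrow> \<theta> (p \<epsilon> k) + dual_value f g A \<le> ereal \<epsilon>) \<and>
            L \<epsilon> / \<kappa> \<epsilon> = 1 + 8 * R\<^sup>2 / \<epsilon>\<^sup>2 * ((onorm A)\<^sup>2 * Df + Dg)) \<and>
         (\<exists>N :: real \<Rightarrow> nat.
            (\<forall>\<epsilon>>0. real (N \<epsilon>) \<ge> threshold \<epsilon> \<and>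
               (\<forall>k\<ge>N \<epsilon>. \<theta> (p \<epsilon> k) + dual_value f g A \<le> ereal \<epsilon>)) \<and>
            (\<lambda>\<epsilon>. real (N \<epsilon>)) \<in> O[at_right 0](\<lambda>\<epsilon>. 1 / \<epsilon> * ln (1 / \<epsilon>)))"
proof -
  have accuracy: "\<theta> (p \<epsilon> k) + dual_value f g A \<le> ereal \<epsilon>"
    if "\<epsilon> > 0" "threshold \<epsilon> \<le> real k" for \<epsilon> k
    using that double_smoothing_accuracy[OF f g A(1) pstar Df_pos Dg_pos that(1), of k]
    unfolding threshold_def p_def L_def \<kappa>_def \<mu>_def \<rho>_def \<theta>_def Df_def Dg_def by blast
  have ratio: "L \<epsilon> / \<kappa> \<epsilon> = 1 + 8 * R\<^sup>2 / \<epsilon>\<^sup>2 * ((onorm A)\<^sup>2 * Df + Dg)" if "\<epsilon> > 0" for \<epsilon>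
    using that pstar(2) Df_pos Dg_pos
    unfolding L_def \<kappa>_def \<mu>_def \<rho>_def Df_def[symmetric] Dg_def[symmetric]
    by (simp add: field_simps power2_eq_square)
  show ?thesis
  proof (intro conjI allI impI)
    fix \<epsilon> :: real assume \<epsilon>: "\<epsilon> > 0"
    show "L \<epsilon> / \<kappa> \<epsilon> = 1 + 8 * R\<^sup>2 / \<epsilon>\<^sup>2 * ((onorm A)\<^sup>2 * Df + Dg)"
      by (rule ratio[OF \<epsilon>])
  next
    fix \<epsilon> :: real and k :: nat assume "\<epsilon> > 0" "threshold \<epsilon> \<le> real k"
    then show "\<theta> (p \<epsilon> k) + dual_value f g A \<le> ereal \<epsilon>" by (rule accuracy)
  next
    \<comment> \<open>Rounding the threshold up makes every \<open>k \<ge> N \<epsilon>\<close>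
      satisfy it.\<close>
    define N where "N \<epsilon> = nat \<lceil>threshold \<epsilon>\<rceil>" for \<epsilon>
    have N: "threshold \<epsilon> \<le> real (N \<epsilon>)" for \<epsilon>
      unfolding N_def by (rule real_nat_ceiling_ge)
    \<comment> \<open>Chosen so that \<open>L \<epsilon> / \<kappa> \<epsilon> = 1 + b /
      \<epsilon>\<^sup>2\<close>, the form in \<open>iteration_count_bigo\<close>.\<close>
    define b where "b = 8 * R\<^sup>2 * ((onorm A)\<^sup>2 * Df + Dg)"
    have "\<theta> pstar \<le> \<theta> 0"
      unfolding \<theta>_def by (rule dual_solution_theta(2)[OF f(1,3,4) g(1,3,4) pstar(1)])
    then have \<Delta>: "0 \<le> real_of_ereal (\<theta> 0) - real_of_ereal (\<theta> pstar)"
      by (simp add: \<theta>_def dual_theta_eq[OF f(1,3,4) g(1,3,4)])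
    have b: "0 \<le> b" using Df_pos Dg_pos by (simp add: b_def Df_def Dg_def)
    \<comment> \<open>The ratio identity is available for positive \<epsilon>, which is all that
      \<open>at_right 0\<close> sees.\<close>
    have "\<forall>\<^sub>F \<epsilon> in at_right 0. real (N \<epsilon>) = real (nat \<lceil>2 * sqrt (1 + b / \<epsilon>\<^sup>2) *
        ln (25 * (real_of_ereal (\<theta> 0) - real_of_ereal (\<theta> pstar) + \<epsilon> / 2) / (2 * \<epsilon>))\<rceil>)"
      using eventually_at_right_less[of 0]
    proof eventually_elim
      case (elim \<epsilon>)
      then show ?case by (simp add: N_def threshold_def ratio b_def)
    qed
    then have "(\<lambda>\<epsilon>. real (N \<epsilon>)) \<in> O[at_right 0](\<lambda>\<epsilon>. 1 / \<epsilon> * ln (1 / \<epsilon>))"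
      by (rule landau_o.big.in_cong[THEN iffD2]) (rule iteration_count_bigo[OF b \<Delta>])
    moreover have "\<forall>\<epsilon>>0. threshold \<epsilon> \<le> real (N \<epsilon>) \<and>
        (\<forall>k\<ge>N \<epsilon>. \<theta> (p \<epsilon> k) + dual_value f g A \<le> ereal \<epsilon>)"
    proof (intro allI impI conjI)
      fix \<epsilon> :: real and k assume "\<epsilon> > 0" "N \<epsilon> \<le> k"
      then show "\<theta> (p \<epsilon> k) + dual_value f g A \<le> ereal \<epsilon>"
        using N[of \<epsilon>] by (intro accuracy) auto
    qed (rule N)
    ultimately show "\<exists>N :: real \<Rightarrow> nat.
              (\<forall>\<epsilon>>0. real (N \<epsilon>) \<ge> threshold \<epsilon> \<and>
                 (\<forall>k\<ge>N \<epsilon>. \<theta> (p \<epsilon> k) + dual_value f g A \<le> ereal \<epsilon>)) \<and>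
              (\<lambda>\<epsilon>. real (N \<epsilon>)) \<in> O[at_right 0](\<lambda>\<epsilon>. 1 / \<epsilon> * ln (1 / \<epsilon>))"
      by blast
  qed
qed

end
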